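(* Let $f:\mathbb{C}\to\mathbb{C}$ be a transcendental entire function with a logarithmic tract $D$. Then, given any positive sequence $(a_n)$ such that $a_n\to\infty$ as $n\to\infty$ and satisfying $a_{n+1}=O(M_D(a_n))$ as $n\to\infty$, there exist $$\zeta\in J(f)\cap\overline{D}\quad\text{and}\quad N\in\mathbb{N}$$ such that $$f^n(\zeta)\in\overline{D}\quad\text{for all } n\geq 1,$$ and $$1\leq\frac{|f^n(\zeta)|}{a_n}\leq 1+o(1)\quad\text{for } n\geq N,$$ where $o(1)$ denotes a quantity tending to $0$ as $n\to\infty$.
   Context: $f^n$ denotes the $n$th iterate of $f$, and $\mathbb{N}$ denotes the non-negative integers. The Fatou set $F(f)$ is the subset of $\mathbb{C}$ where the iterates $(f^n)$ form a normal family, and the Julia set is $J(f)=\mathbb{C}\setminus F(f)$. Direct tract: let $D$ be an unbounded domain in $\mathbb{C}$ whose boundary consists of piecewise smooth curves and whose complement is unbounded. Let $f$ be a complex valued function whose domain of definition contains the closure $\overline{D}$. Then $D$ is a direct tract of $f$ if $f$ is holomorphic in $D$, continuous in $\overline{D}$, and there exists $R>0$ such that $|f(z)|=R$ for $z\in\partial D$ while $|f(z)|>R$ for $z\in D$. If, in addition, the restriction $f:D\to\{z\in\mathbb{C}:|z|>R\}$ is a universal covering, then $D$ is a logarithmic tract of $f$. For a tract $D$ of $f$, $M_D(\rho)=\max_{|z|=\rho,\ z\in D}|f(z)|$ (defined whenever the circle $|z|=\rho$ meets $D$, hence for all sufficiently large $\rho$). *)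

theory Defs
  imports "HOL-Complex_Analysis.Complex_Analysis" "HOL-Library.Landau_Symbols"
begin

definition transcendental_entire :: "(complex \<Rightarrow> complex) \<Rightarrow> bool" where
  "transcendental_entire f \<longleftrightarrow>
     f holomorphic_on UNIV \<and> \<not> (\<exists>p. \<forall>z. f z = poly p z)"

text \<open>
  Normality in the sense of Montel, meant for families of holomorphic functions on a domain
  \<open>U\<close>: the limit \<open>\<infinity>\<close> is allowed. A finite limit \<open>g\<close> is then
  automatically holomorphic.
\<close>

definition normal_family_on :: "(complex \<Rightarrow> complex) set \<Rightarrow> complex set \<Rightarrow> bool" where
  "normal_family_on \<F> U \<longleftrightarrow>
     (\<forall>F :: nat \<Rightarrow> complex \<Rightarrow> complex. range F \<subseteq> \<F> \<longrightarrow>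
       (\<exists>r :: nat \<Rightarrow> nat. strict_mono r \<and>
         ((\<exists>g. \<forall>K. compact K \<and> K \<subseteq> U \<longrightarrow>
              uniform_limit K (\<lambda>n. F (r n)) g sequentially) \<or>
          (\<forall>K. compact K \<and> K \<subseteq> U \<longrightarrow>
              (\<forall>B :: real. \<forall>\<^sub>F n in sequentially. \<forall>z\<in>K. norm (F (r n) z) > B)))))"

definition Fatou_set :: "(complex \<Rightarrow> complex) \<Rightarrow> complex set" where
  "Fatou_set f =
     {z. \<exists>U. open U \<and> connected U \<and> z \<in> U \<and> normal_family_on (range (\<lambda>n. f ^^ n)) U}"

definition Julia_set :: "(complex \<Rightarrow> complex) \<Rightarrow> complex set" where
  "Julia_set f = - Fatou_set f"

definition smooth_curve_on :: "(real \<Rightarrow> complex) \<Rightarrow> real \<Rightarrow> real \<Rightarrow> bool" where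
  "smooth_curve_on \<gamma> a b \<longleftrightarrow>
     (\<exists>\<gamma>'. continuous_on {a..b} \<gamma>' \<and>
        (\<forall>t\<in>{a..b}. (\<gamma> has_vector_derivative \<gamma>' t) (at t within {a..b}) \<and> \<gamma>' t \<noteq> 0))"

definition piecewise_smooth_curve :: "(real \<Rightarrow> complex) \<Rightarrow> bool" where
  "piecewise_smooth_curve \<gamma> \<longleftrightarrow>
     (\<exists>(s :: nat \<Rightarrow> real) m. s 0 = 0 \<and> s m = 1 \<and>
        (\<forall>i<m. s i < s (Suc i) \<and> smooth_curve_on \<gamma> (s i) (s (Suc i))))"

text \<open>
  The curves bounding an unbounded domain need not be compact. An unbounded curve is represented
  by countably many compact pieces, each parametrised over \<open>{0..1}\<close>; local finiteness
  says that the curves do not accumulate at a point of the plane.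
\<close>

definition consists_of_piecewise_smooth_curves :: "complex set \<Rightarrow> bool" where
  "consists_of_piecewise_smooth_curves S \<longleftrightarrow>
     (\<exists>\<Gamma>. (\<forall>\<gamma>\<in>\<Gamma>. piecewise_smooth_curve \<gamma>) \<and>
          S = (\<Union>\<gamma>\<in>\<Gamma>. path_image \<gamma>) \<and>
          (\<forall>K. compact K \<longrightarrow> finite {\<gamma>\<in>\<Gamma>. path_image \<gamma> \<inter> K \<noteq> {}}))"

definition direct_tract_with :: "real \<Rightarrow> (complex \<Rightarrow> complex) \<Rightarrow> complex set \<Rightarrow> bool" where
  "direct_tract_with R f D \<longleftrightarrow>
     open D \<and> connected D \<and> \<not> bounded D \<and> \<not> bounded (- D) \<and>
     consists_of_piecewise_smooth_curves (frontier D) \<and>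
     f holomorphic_on D \<and> continuous_on (closure D) f \<and>
     R > 0 \<and> (\<forall>z\<in>frontier D. norm (f z) = R) \<and> (\<forall>z\<in>D. norm (f z) > R)"

definition logarithmic_tract :: "(complex \<Rightarrow> complex) \<Rightarrow> complex set \<Rightarrow> bool" where
  "logarithmic_tract f D \<longleftrightarrow>
     (\<exists>R. direct_tract_with R f D \<and>
          covering_space D f {z. norm z > R} \<and> simply_connected D)"

text \<open>
  For a direct tract \<open>D\<close> of \<open>f\<close> this supremum is a maximum as soon as the circle
  meets \<open>D\<close>: on the compact set \<open>closure D \<inter> sphere 0 \<rho>\<close> the modulus
  equals \<open>R\<close> outside \<open>D\<close> and exceeds \<open>R\<close> inside \<open>D\<close>. If the circle
  misses \<open>D\<close> the value is meaningless.
\<close>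

definition max_modulus_on :: "(complex \<Rightarrow> complex) \<Rightarrow> complex set \<Rightarrow> real \<Rightarrow> real" where
  "max_modulus_on f D \<rho> = (SUP z\<in>D \<inter> sphere 0 \<rho>. norm (f z))"

end

theory Submission
  imports Defs
begin

text \<open>
  Since \<open>D\<close> is simply connected and \<open>f\<close> covers \<open>{|z| > R}\<close>, the map \<open>f\<close> is the exponential
  function in disguise: there is a conformal bijection \<open>F\<close> of the half-plane \<open>Re w > ln R\<close> onto
  \<open>D\<close> with \<open>f (F w) = exp w\<close> (\<open>covering_parametrization_by_exp\<close>). Fix a point \<open>p\<close> outside
  \<open>D\<close> and write \<open>F = p + exp g\<close>. As \<open>F\<close> is injective, the image of \<open>g\<close> cannot contain two
  points that differ by \<open>2\<pi>i\<close>, hence contains no disc of radius larger than \<open>\<pi>\<close>, and Bloch's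
  theorem gives \<open>|g'(w)| \<le> 12\<pi> / (Re w - ln R)\<close>. All later estimates derive from this one.

  Far to the right in the half-plane the estimate says that \<open>|F|\<close> is almost constant on discs of
  radius 5. If such a disc is centred at a point \<open>w\<close> with \<open>Re w = ln \<alpha>'\<close>, its image under
  \<open>exp\<close> contains the full annulus \<open>{\<alpha>' \<le> |z| \<le> 2\<alpha>'}\<close>. So if in addition
  \<open>|F w|\<close> is slightly larger than \<open>\<alpha>\<close>, its image under \<open>F\<close> is a compact piece of \<open>D\<close> that
  lies in a thin annulus \<open>{\<alpha> \<le> |z| \<le> (1 + \<epsilon>)\<alpha>}\<close> and that \<open>f\<close> maps over the whole of
  \<open>{\<alpha>' \<le> |z| \<le> 2\<alpha>'}\<close> (\<open>annulus_step\<close>). The existence of \<open>w\<close> is where the growth hypothesis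
  enters. The line \<open>Re w = ln \<alpha>'\<close> carries arbitrarily large values of \<open>|F|\<close>, because the fibres
  of \<open>f\<close> in \<open>D\<close> are infinite and discrete, so it suffices to find one value that is not much larger
  than \<open>\<alpha>\<close>. If \<open>\<alpha>'\<close> is at most \<open>|f(z)|\<close> for some \<open>z \<in> D\<close> with \<open>|z| = \<alpha>\<close>, a connectedness
  argument in the disc \<open>|z| \<le> \<alpha>\<close> supplies it (\<open>boundary_modulus_attained_in_cball\<close>); if
  \<open>\<alpha>'\<close> exceeds \<open>|f(z)|\<close> by a bounded factor, one moves a bounded distance to the right in the
  half-plane, which changes \<open>|F|\<close> by a factor close to 1.

  Applied with \<open>\<alpha> = a n\<close> and \<open>\<alpha>' = a (n + 1)\<close> for all large \<open>n\<close>, this gives compact sets each of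
  which is mapped over the next, hence a point whose orbit follows them (\<open>slow_escape_in_tract\<close>).
  Finitely many preimages inside \<open>D\<close> put the indices right.

  Membership in the Julia set holds for every orbit that escapes inside the tract. The estimate for
  \<open>g'\<close> reads \<open>|f'(z)| |z| \<ge> |f(z)| ln |f(z)| / (48\<pi>)\<close> for large \<open>z\<close> and \<open>f(z)\<close>, so
  \<open>|(f^n)'| / (|f^n| ln |f^n|)\<close> tends to infinity along the orbit. In a neighbourhood where a
  subsequence of the iterates tends to infinity this quotient stays bounded on that subsequence, by
  the Schwarz-Pick inequality for a logarithm of \<open>f^n\<close>.
\<close>

section \<open>Conformal parametrization of a logarithmic tract\<close>
lemma simply_connected_holomorphic_log:
  assumes "open S" "simply_connected S" "f holomorphic_on S" "\<And>z. z \<in> S \<Longrightarrow> f z \<noteq> 0"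
  obtains g where "g holomorphic_on S" "\<And>z. z \<in> S \<Longrightarrow> f z = exp (g z)"
proof -
  have "\<exists>g. g holomorphic_on S \<and> (\<forall>z\<in>S. f z = exp (g z))"
    using assms
    by (intro simply_connected_eq_holomorphic_log[THEN iffD1, THEN conjunct2, rule_format]) auto
  then show thesis
    using that by auto
qed

text \<open>
  Two universal coverings of \<open>{|z| > R}\<close> are isomorphic: \<open>F\<close> is the lift of \<open>exp\<close> through \<open>f\<close>,
  a logarithm \<open>\<phi>\<close> of \<open>f\<close> on \<open>D\<close> is a lift of \<open>f\<close> through \<open>exp\<close>, and uniqueness of lifts
  makes them inverse to each other once they match at one point. Thus \<open>F\<close> is holomorphic as
  the inverse of an injective holomorphic function.
\<close>
lemma covering_parametrization_by_exp:
  fixes f :: "complex \<Rightarrow> complex"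
  assumes cov: "covering_space D f {z. norm z > R}" and sc: "simply_connected D"
    and "open D" "D \<noteq> {}" and holf: "f holomorphic_on D" and "R > 0"
  obtains F where "F holomorphic_on {w. Re w > ln R}" "inj_on F {w. Re w > ln R}"
    "F ` {w. Re w > ln R} = D" "\<And>w. Re w > ln R \<Longrightarrow> f (F w) = exp w"
proof -
  let ?H = "{w. Re w > ln R}"
  have fD: "norm (f z) > R" if "z \<in> D" for z
    using covering_space_imp_surjective[OF cov] that by auto
  have "f z \<noteq> 0" if "z \<in> D" for z
    using fD[OF that] \<open>R > 0\<close> by force
  then obtain \<phi> where hol\<phi>: "\<phi> holomorphic_on D" and \<phi>: "\<And>z. z \<in> D \<Longrightarrow> f z = exp (\<phi> z)"
    by (rule simply_connected_holomorphic_log[OF \<open>open D\<close> sc holf]) blast+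
  have \<phi>H: "\<phi> z \<in> ?H" if "z \<in> D" for z
  proof -
    have "exp (ln R) < exp (Re (\<phi> z))"
      using fD[OF that] \<phi>[OF that] \<open>R > 0\<close> by (simp add: norm_exp_eq_Re)
    then show ?thesis
      by simp
  qed
  obtain z0 where z0: "z0 \<in> D"
    using \<open>D \<noteq> {}\<close> by blast
  have expH: "exp \<in> ?H \<rightarrow> {z. norm z > R}"
    using \<open>R > 0\<close> by (auto simp: norm_exp_eq_Re) (metis exp_less_cancel_iff exp_ln)
  have conv: "convex ?H"
    by (rule convex_halfspace_Re_gt)
  have "simply_connected ?H" "locally path_connected ?H" "continuous_on ?H (exp :: complex \<Rightarrow> complex)"
    using conv by (auto intro: convex_imp_simply_connected convex_imp_locally_path_connected continuous_intros)
  note lift = covering_space_lift_strong[OF cov z0 \<phi>H[OF z0] this expH \<phi>[OF z0, symmetric]]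
  obtain F where contF: "continuous_on ?H F" and FD: "F \<in> ?H \<rightarrow> D" and F0: "F (\<phi> z0) = z0"
    and F: "\<And>w. w \<in> ?H \<Longrightarrow> f (F w) = exp w"
  proof (rule lift)
    fix g assume "continuous_on ?H g" "g \<in> ?H \<rightarrow> D" "g (\<phi> z0) = z0" "\<And>w. w \<in> ?H \<Longrightarrow> f (g w) = exp w"
    then show thesis
      by (rule that[of g])
  qed
  have cont\<phi>: "continuous_on D \<phi>"
    using hol\<phi> by (rule holomorphic_on_imp_continuous_on)
  have \<phi>F: "\<phi> (F w) = w" if w: "w \<in> ?H" for w
  proof (rule covering_space_lift_unique[OF covering_space_exp_punctured_plane, where T = ?H and a = "\<phi> z0" and f = exp
        and ?g1.0 = "\<lambda>w. \<phi> (F w)" and ?g2.0 = "\<lambda>w. w"])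
    show "continuous_on ?H (\<lambda>w. \<phi> (F w))"
      using FD by (intro continuous_on_compose2[OF cont\<phi> contF]) auto
    show "\<And>x. x \<in> ?H \<Longrightarrow> exp x = exp (\<phi> (F x))"
      using F FD \<phi> by (metis PiE)
    show "connected ?H"
      using conv by (rule convex_connected)
  qed (use w \<phi>H[OF z0] F0 in \<open>auto intro!: continuous_intros\<close>)
  have F\<phi>: "F (\<phi> z) = z" if z: "z \<in> D" for z
  proof (rule covering_space_lift_unique[OF cov, where T = D and a = z0 and f = f
        and ?g1.0 = "\<lambda>z. F (\<phi> z)" and ?g2.0 = "\<lambda>z. z"])
    show "continuous_on D (\<lambda>z. F (\<phi> z))"
      using \<phi>H by (intro continuous_on_compose2[OF contF cont\<phi>]) auto
    show "continuous_on D f"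
      using holf by (rule holomorphic_on_imp_continuous_on)
    show "\<And>x. x \<in> D \<Longrightarrow> f x = f (F (\<phi> x))"
      using F \<phi> \<phi>H by auto
    show "(\<lambda>z. F (\<phi> z)) \<in> D \<rightarrow> D"
      using FD \<phi>H by blast
    show "f \<in> D \<rightarrow> {z. norm z > R}"
      using fD by auto
    show "connected D"
      using sc by (rule simply_connected_imp_connected)
  qed (use z z0 F0 in auto)
  have im: "\<phi> ` D = ?H"
    using \<phi>F \<phi>H FD by force
  have "inj_on \<phi> D"
    using F\<phi> by (metis inj_onI)
  from holomorphic_has_inverse[OF hol\<phi> \<open>open D\<close> this]
  obtain g where g: "g holomorphic_on \<phi> ` D" "\<And>z. z \<in> D \<Longrightarrow> g (\<phi> z) = z"
    by metis
  have "F holomorphic_on ?H"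
    using g(1) unfolding im
  proof (rule holomorphic_transform)
    fix w assume "w \<in> ?H"
    then show "g w = F w"
      using g(2) \<phi>F FD by (metis PiE)
  qed
  moreover have "inj_on F ?H"
    using \<phi>F by (metis inj_onI)
  moreover have "F ` ?H = D"
    using FD F\<phi> \<phi>H by (auto simp: image_iff) (metis mem_Collect_eq)
  ultimately show thesis
    using that F by auto
qed

section \<open>Distortion of univalent functions on a half-plane\<close>

text \<open>
  By Bloch's theorem the image of \<open>g\<close> contains a disc of radius \<open>r |g'(w)| / 12\<close>. If this radius
  exceeded \<open>\<pi>\<close>, the disc would contain two points at distance \<open>2\<pi>\<close> on a vertical line, at which
  \<open>exp\<close> takes the same value.
\<close>
lemma norm_deriv_le_if_inj_exp:
  assumes holg: "g holomorphic_on ball w r" and "r > 0" and inj: "inj_on (\<lambda>u. exp (g u)) (ball w r)"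
  shows "r * norm (deriv g w) \<le> 12 * pi"
proof (rule ccontr)
  assume "\<not> ?thesis"
  then have big: "pi < r * norm (deriv g w) / 12"
    by simp
  obtain b where b: "ball b (r * norm (deriv g w) / 12) \<subseteq> g ` ball w r"
    using Bloch[OF holg \<open>r > 0\<close> order_refl] by blast
  have "b + \<i> * pi \<in> ball b (r * norm (deriv g w) / 12)" "b - \<i> * pi \<in> ball b (r * norm (deriv g w) / 12)"
    using big by (auto simp: dist_norm norm_mult)
  then have "b + \<i> * pi \<in> g ` ball w r" "b - \<i> * pi \<in> g ` ball w r"
    using b by blast+
  then obtain u v where uv: "u \<in> ball w r" "g u = b + \<i> * pi" "v \<in> ball w r" "g v = b - \<i> * pi"
    by (metis imageE)
  have "exp (g u) = exp (g v)"
    unfolding uv by (simp add: exp_add exp_diff mult.commute)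
  then have "u = v"
    by (rule inj_onD[OF inj _ uv(1,3)])
  with uv show False
    by simp
qed

text \<open>
  The disc about \<open>w\<close> that touches the boundary of the half-plane has radius \<open>Re w - c\<close>. Using a
  point \<open>p\<close> outside the image in place of the origin keeps the logarithm available when the image
  surrounds or contains 0.
\<close>
lemma univalent_half_plane_log_deriv:
  fixes F :: "complex \<Rightarrow> complex"
  assumes holF: "F holomorphic_on {w. Re w > c}" and inj: "inj_on F {w. Re w > c}"
    and p: "p \<notin> F ` {w. Re w > c}"
  shows "\<exists>g. g holomorphic_on {w. Re w > c} \<and>
    (\<forall>w. Re w > c \<longrightarrow> F w = p + exp (g w) \<and> norm (deriv g w) \<le> 12 * pi / (Re w - c))"
proof -
  let ?H = "{w. Re w > c}"
  have "simply_connected ?H"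
    by (simp add: convex_imp_simply_connected convex_halfspace_Re_gt)
  moreover have "(\<lambda>w. F w - p) holomorphic_on ?H"
    using holF by (intro holomorphic_intros)
  moreover have "F w - p \<noteq> 0" if "w \<in> ?H" for w
    using p that by auto
  ultimately obtain g where holg: "g holomorphic_on ?H" and g: "\<And>w. w \<in> ?H \<Longrightarrow> F w - p = exp (g w)"
    by (rule simply_connected_holomorphic_log[OF open_halfspace_Re_gt[of c]]) blast+
  have "norm (deriv g w) \<le> 12 * pi / (Re w - c)" if w: "Re w > c" for w
  proof -
    have sub: "ball w (Re w - c) \<subseteq> ?H"
    proof
      fix u assume "u \<in> ball w (Re w - c)"
      then show "u \<in> ?H"
        using complex_Re_le_cmod[of "w - u"] by (simp add: dist_norm)
    qed
    have "inj_on (\<lambda>u. exp (g u)) (ball w (Re w - c))"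
    proof (rule inj_onI)
      fix u v assume uv: "u \<in> ball w (Re w - c)" "v \<in> ball w (Re w - c)" "exp (g u) = exp (g v)"
      then have H: "u \<in> ?H" "v \<in> ?H"
        using sub by blast+
      have "F u - p = F v - p"
        using g[OF H(1)] g[OF H(2)] uv(3) by presburger
      then have "F u = F v"
        by simp
      then show "u = v"
        by (rule inj_onD[OF inj]) (use H in auto)
    qed
    from norm_deriv_le_if_inj_exp[OF holomorphic_on_subset[OF holg sub] _ this]
    show ?thesis
      using w by (simp add: field_simps)
  qed
  moreover have "F w = p + exp (g w)" if "Re w > c" for w
    using g[of w] that by (simp add: algebra_simps)
  ultimately show ?thesis
    using holg by blast
qed

text \<open>
  Integrating the bound for the logarithmic derivative along the segment from \<open>w\<close> to \<open>u\<close>.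
\<close>
lemma univalent_half_plane_distortion:
  fixes F :: "complex \<Rightarrow> complex"
  assumes "F holomorphic_on {w. Re w > c}" "inj_on F {w. Re w > c}" "p \<notin> F ` {w. Re w > c}"
    and "c < s" "s \<le> Re u" "s \<le> Re w"
  shows "norm (F u - p) \<le> exp (12 * pi * norm (u - w) / (s - c)) * norm (F w - p)"
proof -
  from univalent_half_plane_log_deriv[OF assms(1-3)] obtain g where holg: "g holomorphic_on {w. Re w > c}"
    and g_all: "\<forall>w. Re w > c \<longrightarrow> F w = p + exp (g w) \<and> norm (deriv g w) \<le> 12 * pi / (Re w - c)"
    by (elim exE conjE)
  have g: "F w = p + exp (g w)" and dg: "norm (deriv g w) \<le> 12 * pi / (Re w - c)" if "Re w > c" for w
    using g_all that by simp_all
  have "norm (g u - g w) \<le> 12 * pi / (s - c) * norm (u - w)"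
  proof (rule field_differentiable_bound[OF convex_halfspace_Re_ge[of s], where f = g and f' = "deriv g"])
    fix z assume z: "z \<in> {z. s \<le> Re z}"
    then show "(g has_field_derivative deriv g z) (at z within {z. s \<le> Re z})"
      using z \<open>c < s\<close>
      by (intro has_field_derivative_at_within[OF holomorphic_derivI[OF holg open_halfspace_Re_gt[of c]]]) auto
    show "norm (deriv g z) \<le> 12 * pi / (s - c)"
      using dg[of z] z \<open>c < s\<close> frac_le[of "12*pi" "12*pi" "s-c" "Re z - c"] by auto
  qed (use assms in auto)
  then have "Re (g u) \<le> 12 * pi * norm (u - w) / (s - c) + Re (g w)"
    using complex_Re_le_cmod[of "g u - g w"] by simp
  then show ?thesis
    using g[of u] g[of w] assms by (simp add: norm_exp_eq_Re flip: exp_add)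
qed

section \<open>Escaping orbits and the Julia set\<close>

text \<open>
  The Schwarz-Pick inequality at the centre of the disc for a logarithm \<open>h\<close> of \<open>G\<close>, which has
  positive real part: the Moebius map \<open>k\<close> in the proof takes the right half-plane to the unit disc and
  \<open>h \<zeta>\<close> to 0.
\<close>
lemma norm_deriv_le_if_norm_gt_1:
  assumes holG: "G holomorphic_on ball \<zeta> r" and G: "\<And>z. z \<in> ball \<zeta> r \<Longrightarrow> norm (G z) > 1"
    and "0 < \<rho>" "\<rho> < r"
  shows "\<rho> * norm (deriv G \<zeta>) \<le> 2 * norm (G \<zeta>) * ln (norm (G \<zeta>))"
proof -
  have \<zeta>: "\<zeta> \<in> ball \<zeta> r"
    using assms by simp
  have "simply_connected (ball \<zeta> r)"
    by (simp add: convex_imp_simply_connected)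
  moreover have "G z \<noteq> 0" if "z \<in> ball \<zeta> r" for z
    using G[OF that] by auto
  ultimately obtain h where holh: "h holomorphic_on ball \<zeta> r" and h: "\<And>z. z \<in> ball \<zeta> r \<Longrightarrow> G z = exp (h z)"
    by (rule simply_connected_holomorphic_log[OF open_ball _ holG]) blast+
  have Re: "Re (h z) > 0" if "z \<in> ball \<zeta> r" for z
    using G[OF that] h[OF that] by simp
  define k where "k = (\<lambda>z. (h z - h \<zeta>) / (h z + cnj (h \<zeta>)))"
  have nz: "h z + cnj (h \<zeta>) \<noteq> 0" if "z \<in> ball \<zeta> r" for z
    using Re[OF that] Re[OF \<zeta>] by (auto simp: complex_eq_iff)
  have holk: "k holomorphic_on ball \<zeta> r"
    unfolding k_def using nz holh by (intro holomorphic_intros) auto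
  have k1: "norm (k z) \<le> 1" if "z \<in> ball \<zeta> r" for z
  proof -
    have "(norm (h z - h \<zeta>))\<^sup>2 \<le> (norm (h z + cnj (h \<zeta>)))\<^sup>2"
      using mult_pos_pos[OF Re[OF that] Re[OF \<zeta>]]
      unfolding cmod_power2 by (simp add: power2_eq_square algebra_simps)
    then show ?thesis
      using nz[OF that] by (simp add: k_def norm_divide divide_le_eq_1 power2_le_iff_abs_le)
  qed
  have "norm ((deriv ^^ 1) k \<zeta>) \<le> fact 1 * 1 / \<rho> ^ 1"
  proof (rule Cauchy_inequality)
    show "k holomorphic_on ball \<zeta> \<rho>"
      using assms by (intro holomorphic_on_subset[OF holk]) auto
    show "continuous_on (cball \<zeta> \<rho>) k"
      using assms by (intro holomorphic_on_imp_continuous_on holomorphic_on_subset[OF holk]) auto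
  qed (use k1 assms in \<open>auto simp: dist_norm\<close>)
  then have dk: "norm (deriv k \<zeta>) \<le> 1 / \<rho>"
    by simp
  have dh: "(h has_field_derivative deriv h \<zeta>) (at \<zeta>)"
    using holh \<zeta> by (intro holomorphic_derivI) auto
  have "(k has_field_derivative deriv h \<zeta> / (h \<zeta> + cnj (h \<zeta>))) (at \<zeta>)"
    unfolding k_def
    using DERIV_divide[OF DERIV_diff[OF dh DERIV_const[of "h \<zeta>"]] DERIV_add[OF dh DERIV_const[of "cnj (h \<zeta>)"]] nz[OF \<zeta>]]
      nz[OF \<zeta>] by simp
  then have "deriv k \<zeta> = deriv h \<zeta> / (2 * Re (h \<zeta>))"
    by (simp add: DERIV_imp_deriv complex_add_cnj)
  then have "norm (deriv k \<zeta>) = norm (deriv h \<zeta>) / (2 * Re (h \<zeta>))"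
    using Re[OF \<zeta>] by (simp add: norm_divide norm_mult)
  with dk have 1: "\<rho> * norm (deriv h \<zeta>) \<le> 2 * Re (h \<zeta>)"
    using Re[OF \<zeta>] \<open>\<rho> > 0\<close> by (simp add: field_simps)
  have "((\<lambda>z. exp (h z)) has_field_derivative exp (h \<zeta>) * deriv h \<zeta>) (at \<zeta>)"
    by (auto intro!: derivative_eq_intros dh)
  then have "(G has_field_derivative exp (h \<zeta>) * deriv h \<zeta>) (at \<zeta>)"
    by (rule has_field_derivative_transform_within_open[OF _ open_ball \<zeta>]) (simp add: h)
  then have "deriv G \<zeta> = G \<zeta> * deriv h \<zeta>"
    by (simp add: DERIV_imp_deriv h[OF \<zeta>])
  moreover have "ln (norm (G \<zeta>)) = Re (h \<zeta>)"
    by (simp add: h[OF \<zeta>])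
  ultimately show ?thesis
    using mult_left_mono[OF 1, of "norm (G \<zeta>)"] by (simp add: norm_mult algebra_simps)
qed

lemma holomorphic_on_funpow:
  fixes f :: "complex \<Rightarrow> complex"
  assumes "f holomorphic_on UNIV"
  shows "(f ^^ n) holomorphic_on UNIV"
proof (induction n)
  case 0
  show ?case
    by (simp add: id_def)
next
  case (Suc n)
  then show ?case
    using holomorphic_on_compose_gen[OF Suc assms] by (simp add: o_def)
qed

text \<open>
  As the orbit of \<open>\<zeta>\<close> escapes, a subsequence of the iterates that converges locally uniformly near
  \<open>\<zeta>\<close> can only tend to infinity, so its members eventually have modulus above 1 on a fixed disc.
\<close>
lemma escaping_Fatou_orbit_derivative_bound:
  fixes f :: "complex \<Rightarrow> complex"
  assumes entire: "f holomorphic_on UNIV" and esc: "filterlim (\<lambda>n. norm ((f ^^ n) \<zeta>)) at_top sequentially"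
    and "\<zeta> \<in> Fatou_set f"
  obtains B where "\<exists>\<^sub>F n in sequentially. norm (deriv (f ^^ n) \<zeta>) \<le> B * (norm ((f ^^ n) \<zeta>) * ln (norm ((f ^^ n) \<zeta>)))"
proof -
  have hol: "(f ^^ n) holomorphic_on S" for n S
    using holomorphic_on_subset[OF holomorphic_on_funpow[OF entire]] by simp
  from \<open>\<zeta> \<in> Fatou_set f\<close> obtain U where U: "open U" "\<zeta> \<in> U" "normal_family_on (range (\<lambda>n. f ^^ n)) U"
    unfolding Fatou_set_def by blast
  from U(3) obtain s :: "nat \<Rightarrow> nat" where s: "strict_mono s" and
    cases: "(\<exists>g. \<forall>K. compact K \<and> K \<subseteq> U \<longrightarrow> uniform_limit K (\<lambda>n. f ^^ s n) g sequentially) \<or>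
            (\<forall>K. compact K \<and> K \<subseteq> U \<longrightarrow> (\<forall>B. \<forall>\<^sub>F n in sequentially. \<forall>z\<in>K. norm ((f ^^ s n) z) > B))"
    unfolding normal_family_on_def by blast
  have esc_s: "filterlim (\<lambda>n. norm ((f ^^ s n) \<zeta>)) at_top sequentially"
    using filterlim_compose[OF esc filterlim_subseq[OF s]] .
  from cases have *: "\<forall>\<^sub>F n in sequentially. \<forall>z\<in>K. norm ((f ^^ s n) z) > 1" if "compact K" "K \<subseteq> U" for K
  proof
    assume "\<exists>g. \<forall>K. compact K \<and> K \<subseteq> U \<longrightarrow> uniform_limit K (\<lambda>n. f ^^ s n) g sequentially"
    then obtain g where "uniform_limit {\<zeta>} (\<lambda>n. f ^^ s n) g sequentially"
      using U(2) by (metis compact_sing empty_subsetI insert_subset)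
    then have "(\<lambda>n. (f ^^ s n) \<zeta>) \<longlonglongrightarrow> g \<zeta>"
      by simp
    then have "(\<lambda>n. norm ((f ^^ s n) \<zeta>)) \<longlonglongrightarrow> norm (g \<zeta>)"
      by (rule tendsto_norm)
    from not_tendsto_and_filterlim_at_infinity[OF sequentially_bot this filterlim_at_top_imp_at_infinity[OF esc_s]]
    show ?thesis ..
  qed (use that in blast)
  obtain r where r: "r > 0" "cball \<zeta> r \<subseteq> U"
    using U open_contains_cball by blast
  have ev: "\<forall>\<^sub>F n in sequentially. norm (deriv (f ^^ s n) \<zeta>)
      \<le> 4 / r * (norm ((f ^^ s n) \<zeta>) * ln (norm ((f ^^ s n) \<zeta>)))"
    using *[OF compact_cball r(2)]
  proof eventually_elim
    case (elim n)
    have "r / 2 * norm (deriv (f ^^ s n) \<zeta>) \<le> 2 * norm ((f ^^ s n) \<zeta>) * ln (norm ((f ^^ s n) \<zeta>))"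
      using elim r by (intro norm_deriv_le_if_norm_gt_1[OF hol, of \<zeta> r]) auto
    then show ?case
      using r by (simp add: field_simps)
  qed
  show thesis
  proof (rule that[of "4 / r"])
    show "\<exists>\<^sub>F n in sequentially. norm (deriv (f ^^ n) \<zeta>) \<le> 4 / r * (norm ((f ^^ n) \<zeta>) * ln (norm ((f ^^ n) \<zeta>)))"
      unfolding frequently_sequentially
    proof
      fix N
      from ev obtain M where "\<And>n. n \<ge> M \<Longrightarrow> norm (deriv (f ^^ s n) \<zeta>)
          \<le> 4 / r * (norm ((f ^^ s n) \<zeta>) * ln (norm ((f ^^ s n) \<zeta>)))"
        unfolding eventually_sequentially by blast
      then show "\<exists>n\<ge>N. norm (deriv (f ^^ n) \<zeta>) \<le> 4 / r * (norm ((f ^^ n) \<zeta>) * ln (norm ((f ^^ n) \<zeta>)))"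
        by (intro exI[of _ "s (max N M)"])
          (use seq_suble[OF s, of "max N M"] in \<open>auto intro: order_trans\<close>)
    qed
  qed
qed

text \<open>
  By the chain rule, passing from \<open>n\<close> to \<open>n + 1\<close> multiplies \<open>|(f^n)'| / (|f^n| ln |f^n|)\<close> by at
  least \<open>ln |f^n| / K\<close>, which is eventually at least 2. The quotient therefore tends to infinity, as it
  cannot do in the Fatou set.
\<close>
lemma expanding_escaping_orbit_in_Julia_set:
  fixes f :: "complex \<Rightarrow> complex"
  assumes entire: "f holomorphic_on UNIV" and esc: "filterlim (\<lambda>n. norm ((f ^^ n) \<zeta>)) at_top sequentially"
    and nz: "\<And>n. deriv f ((f ^^ n) \<zeta>) \<noteq> 0"
    and "K > 0" and ex: "\<forall>\<^sub>F n in sequentially. norm ((f ^^ Suc n) \<zeta>) * ln (norm ((f ^^ Suc n) \<zeta>))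
      \<le> K * norm ((f ^^ n) \<zeta>) * norm (deriv f ((f ^^ n) \<zeta>))"
  shows "\<zeta> \<in> Julia_set f"
proof (rule ccontr)
  assume "\<zeta> \<notin> Julia_set f"
  then have "\<zeta> \<in> Fatou_set f"
    by (simp add: Julia_set_def)
  then obtain B where B: "\<exists>\<^sub>F n in sequentially. norm (deriv (f ^^ n) \<zeta>)
      \<le> B * (norm ((f ^^ n) \<zeta>) * ln (norm ((f ^^ n) \<zeta>)))"
    using escaping_Fatou_orbit_derivative_bound[OF entire esc] by metis
  define z where "z = (\<lambda>n. (f ^^ n) \<zeta>)"
  define d where "d = (\<lambda>n. norm (deriv (f ^^ n) \<zeta>))"
  define b where "b = (\<lambda>n. d n / (norm (z n) * ln (norm (z n))))"
  have d_Suc: "d (Suc n) = norm (deriv f (z n)) * d n" for n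
  proof -
    have "(f has_field_derivative deriv f (z n)) (at ((f ^^ n) \<zeta>))"
      unfolding z_def by (intro holomorphic_derivI[OF entire]) auto
    moreover have "((f ^^ n) has_field_derivative deriv (f ^^ n) \<zeta>) (at \<zeta>)"
      by (intro holomorphic_derivI[OF holomorphic_on_funpow[OF entire]]) auto
    ultimately have "((f \<circ> f ^^ n) has_field_derivative deriv f (z n) * deriv (f ^^ n) \<zeta>) (at \<zeta>)"
      by (rule DERIV_chain)
    then have "deriv (f \<circ> f ^^ n) \<zeta> = deriv f (z n) * deriv (f ^^ n) \<zeta>"
      by (rule DERIV_imp_deriv)
    then show ?thesis
      by (simp add: d_def norm_mult)
  qed
  have d_pos: "d n > 0" for n
  proof (induction n)
    case 0
    then show ?case
      by (simp add: d_def id_def)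
  next
    case (Suc n)
    then show ?case
      using nz[of n] by (simp add: d_Suc z_def)
  qed
  have "\<forall>\<^sub>F n in sequentially. norm (z n) > 1 \<and> norm (z (Suc n)) > 1 \<and> ln (norm (z n)) \<ge> 2 * K
      \<and> norm (z (Suc n)) * ln (norm (z (Suc n))) \<le> K * norm (z n) * norm (deriv f (z n))"
  proof (intro eventually_conj)
    have z_top: "filterlim (\<lambda>n. norm (z n)) at_top sequentially"
      using esc by (simp add: z_def)
    then show "\<forall>\<^sub>F n in sequentially. norm (z n) > 1"
      by (simp add: filterlim_at_top_dense)
    then show "\<forall>\<^sub>F n in sequentially. norm (z (Suc n)) > 1"
      by (rule eventually_sequentially_Suc[where P = "\<lambda>n. norm (z n) > 1", THEN iffD2])
    show "\<forall>\<^sub>F n in sequentially. ln (norm (z n)) \<ge> 2 * K"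
      using filterlim_compose[OF ln_at_top z_top] by (simp add: filterlim_at_top)
  qed (use ex in \<open>simp add: z_def\<close>)
  then obtain N where N: "\<And>n. n \<ge> N \<Longrightarrow> norm (z n) > 1" "\<And>n. n \<ge> N \<Longrightarrow> norm (z (Suc n)) > 1"
    "\<And>n. n \<ge> N \<Longrightarrow> ln (norm (z n)) \<ge> 2 * K"
    "\<And>n. n \<ge> N \<Longrightarrow> norm (z (Suc n)) * ln (norm (z (Suc n))) \<le> K * norm (z n) * norm (deriv f (z n))"
    unfolding eventually_sequentially by blast
  have b_Suc: "b (Suc n) \<ge> 2 * b n" if "n \<ge> N" for n
  proof -
    note Nn = N[OF that]
    have "ln (norm (z (Suc n))) > 0" "ln (norm (z n)) > 0"
      by (intro ln_gt_zero Nn)+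
    then have pos: "norm (z (Suc n)) * ln (norm (z (Suc n))) > 0" "ln (norm (z n)) > 0"
      using Nn(2) by (auto intro!: mult_pos_pos simp del: ln_gt_zero_iff)
    have "2 * b n = d n * 2 / (norm (z n) * ln (norm (z n)))"
      by (simp add: b_def)
    also have "\<dots> \<le> d n / (K * norm (z n))"
    proof -
      have "2 * (K * norm (z n)) \<le> norm (z n) * ln (norm (z n))"
        using mult_left_mono[OF Nn(3), of "norm (z n)"] by (simp add: algebra_simps)
      then have "d n * 2 / (norm (z n) * ln (norm (z n))) \<le> d n * 2 / (2 * (K * norm (z n)))"
        using pos(2) Nn(1) \<open>K > 0\<close> d_pos[of n]
        by (intro divide_left_mono mult_pos_pos) (auto simp del: ln_gt_zero_iff)
      then show ?thesis
        by simp
    qed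
    also have "\<dots> = norm (deriv f (z n)) * d n / (K * norm (z n) * norm (deriv f (z n)))"
      using nz[of n] by (simp add: z_def)
    also have "\<dots> \<le> norm (deriv f (z n)) * d n / (norm (z (Suc n)) * ln (norm (z (Suc n))))"
      using Nn(4) pos d_pos[of n] by (intro divide_left_mono) (auto intro!: mult_pos_pos)
    also have "\<dots> = b (Suc n)"
      by (simp add: b_def d_Suc)
    finally show ?thesis .
  qed
  have b_ge: "b (N + k) \<ge> 2 ^ k * b N" for k
  proof (induction k)
    case (Suc k)
    then show ?case
      using b_Suc[of "N + k"] by simp
  qed simp
  have "ln (norm (z N)) > 0" "norm (z N) > 0"
    using N(1)[of N] by (auto intro: ln_gt_zero)
  then have bN: "b N > 0"
    unfolding b_def by (intro divide_pos_pos mult_pos_pos d_pos)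
  obtain k where k: "2 ^ k > B / b N"
    using real_arch_pow[of 2 "B / b N"] by auto
  from B obtain n where n: "n \<ge> N + k" "d n \<le> B * (norm (z n) * ln (norm (z n)))"
    unfolding frequently_sequentially d_def z_def by blast
  moreover have "norm (z n) * ln (norm (z n)) > 0"
    using N(1)[of n] n(1) by (intro mult_pos_pos ln_gt_zero) auto
  ultimately have "b n \<le> B"
    unfolding b_def by (simp only: pos_divide_le_eq)
  moreover have "B < b n"
  proof -
    have "B < 2 ^ k * b N"
      using k bN by (simp add: divide_less_eq)
    also have "\<dots> \<le> 2 ^ (n - N) * b N"
      using bN n by (intro mult_right_mono power_increasing) auto
    also have "\<dots> \<le> b (N + (n - N))"
      by (rule b_ge)
    finally show ?thesis
      using n by simp
  qed
  ultimately show False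
    by simp
qed

section \<open>The tract in logarithmic coordinates\<close>

text \<open>
  The point \<open>p\<close> outside \<open>D\<close> serves as the origin for logarithms of \<open>F\<close>, since 0 may lie in \<open>D\<close>.
\<close>
locale log_tract_parametrization =
  fixes f :: "complex \<Rightarrow> complex" and D :: "complex set" and R :: real
    and F :: "complex \<Rightarrow> complex" and p :: complex
  assumes R_pos: "R > 0"
    and entire: "f holomorphic_on UNIV"
    and nonconstant: "\<not> f constant_on UNIV"
    and holo_F: "F holomorphic_on {w. Re w > ln R}"
    and inj_F: "inj_on F {w. Re w > ln R}"
    and range_F: "F ` {w. Re w > ln R} = D"
    and f_F: "Re w > ln R \<Longrightarrow> f (F w) = exp w"
    and p_notin: "p \<notin> D"
begin

lemma F_in_D: "Re w > ln R \<Longrightarrow> F w \<in> D"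
  using range_F by auto

lemma D_cases:
  assumes "z \<in> D"
  obtains w where "Re w > ln R" "z = F w" "Re w = ln (norm (f z))"
proof -
  from assms range_F obtain w where w: "Re w > ln R" "z = F w"
    by auto
  then have "Re w = ln (norm (f z))"
    by (simp add: f_F)
  with w show thesis
    by (rule that)
qed

lemma norm_f_gt: "z \<in> D \<Longrightarrow> norm (f z) > R"
proof -
  assume "z \<in> D"
  then obtain w where w: "Re w > ln R" "z = F w"
    by (rule D_cases)
  then have "exp (ln R) < exp (Re w)"
    by simp
  then show "norm (f z) > R"
    using w R_pos by (simp add: f_F)
qed

text \<open>
  The shift from \<open>|F - p|\<close> to \<open>|F|\<close> costs terms \<open>|p|\<close>, which become negligible for large \<open>|F|\<close>.
\<close>
lemma distortion:
  assumes "ln R < s" "s \<le> Re u" "s \<le> Re w"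
  shows "norm (F u) \<le> exp (12 * pi * norm (u - w) / (s - ln R)) * (norm (F w) + norm p) + norm p"
proof -
  have "norm (F u) \<le> norm (F u - p) + norm p"
    using norm_triangle_ineq[of "F u - p" p] by simp
  also have "norm (F u - p) \<le> exp (12 * pi * norm (u - w) / (s - ln R)) * norm (F w - p)"
    using p_notin by (intro univalent_half_plane_distortion[OF holo_F inj_F _ assms]) (simp add: range_F)
  also have "\<dots> \<le> exp (12 * pi * norm (u - w) / (s - ln R)) * (norm (F w) + norm p)"
    by (intro mult_left_mono norm_triangle_ineq4) simp
  finally show ?thesis
    by simp
qed

text \<open>
  The expansion of \<open>f\<close> in the tract: differentiate \<open>f (F w) = exp w\<close> and insert the bound for
  \<open>F' / (F - p)\<close>.
\<close>
lemma expansion: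
  assumes "z \<in> D"
  shows "norm (f z) * (ln (norm (f z)) - ln R) \<le> 12 * pi * norm (z - p) * norm (deriv f z)"
proof -
  obtain w where w: "Re w > ln R" "z = F w" "Re w = ln (norm (f z))"
    using D_cases[OF assms] by blast
  have "p \<notin> F ` {w. Re w > ln R}"
    using p_notin range_F by simp
  from univalent_half_plane_log_deriv[OF holo_F inj_F this] obtain g where g: "g holomorphic_on {w. Re w > ln R}"
    and Fg_all: "\<forall>w. Re w > ln R \<longrightarrow> F w = p + exp (g w) \<and> norm (deriv g w) \<le> 12 * pi / (Re w - ln R)"
    by (elim exE conjE)
  have Fg: "F v = p + exp (g v)" and dg: "norm (deriv g v) \<le> 12 * pi / (Re v - ln R)" if "Re v > ln R" for v
    using Fg_all that by simp_all
  have der_g: "(g has_field_derivative deriv g w) (at w)"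
    using w(1) by (intro holomorphic_derivI[OF g open_halfspace_Re_gt]) simp
  have "((\<lambda>v. p + exp (g v)) has_field_derivative exp (g w) * deriv g w) (at w)"
    by (auto intro!: derivative_eq_intros der_g)
  then have der_F: "(F has_field_derivative exp (g w) * deriv g w) (at w)"
    by (rule has_field_derivative_transform_within_open[OF _ open_halfspace_Re_gt[of "ln R"]])
      (use w(1) Fg in auto)
  have "(f has_field_derivative deriv f z) (at (F w))"
    unfolding w(2) by (intro holomorphic_derivI[OF entire]) auto
  from DERIV_chain2[OF this der_F]
  have "((\<lambda>v. f (F v)) has_field_derivative deriv f z * (exp (g w) * deriv g w)) (at w)" .
  moreover have "((\<lambda>v. f (F v)) has_field_derivative exp w) (at w)"
    by (rule has_field_derivative_transform_within_open[OF DERIV_exp open_halfspace_Re_gt[of "ln R"]])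
      (use w(1) f_F in auto)
  ultimately have "exp w = deriv f z * (exp (g w) * deriv g w)"
    by (rule DERIV_unique[symmetric])
  then have "norm (f z) = norm (deriv f z) * (norm (exp (g w)) * norm (deriv g w))"
    using f_F[OF w(1)] w(2) by (metis norm_mult)
  also have "exp (g w) = z - p"
    using Fg[OF w(1)] w(2) by simp
  finally have "norm (f z) = norm (deriv f z) * (norm (z - p) * norm (deriv g w))" .
  also have "\<dots> \<le> norm (deriv f z) * (norm (z - p) * (12 * pi / (Re w - ln R)))"
    by (intro mult_left_mono dg w(1)) auto
  finally have "norm (f z) * (Re w - ln R) \<le> 12 * pi * norm (z - p) * norm (deriv f z)"
    using w(1) by (simp add: field_simps)
  then show ?thesis
    by (simp only: w(3))
qed

lemma deriv_f_nonzero: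
  assumes "z \<in> D"
  shows "deriv f z \<noteq> 0"
proof
  assume "deriv f z = 0"
  then have "norm (f z) * (ln (norm (f z)) - ln R) \<le> 0"
    using expansion[OF assms] by simp
  moreover have "norm (f z) > 0"
    using norm_f_gt[OF assms] R_pos by linarith
  moreover from this have "ln (norm (f z)) > ln R"
    using norm_f_gt[OF assms] R_pos by (subst ln_less_cancel_iff)
  ultimately show False
    by (simp add: mult_le_0_iff)
qed

text \<open>
  The points \<open>w + 2\<pi>ik\<close> are mapped by \<open>F\<close> to infinitely many solutions \<open>z\<close> of \<open>f z = exp w\<close>, of
  which only finitely many lie in a given disc.
\<close>
lemma vertical_line_unbounded:
  assumes "Re w > ln R"
  obtains u where "Re u = Re w" "exp u = exp w" "norm (F u) > B"
proof -
  define u where "u = (\<lambda>k::nat. w + of_int (2 * int k) * pi * \<i>)"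
  have Re_u: "Re (u k) = Re w" and exp_u: "exp (u k) = exp w" for k
    by (auto simp: u_def exp_eq intro!: exI[of _ "int k"])
  have "\<not> (\<forall>k. norm (F (u k)) \<le> B)"
  proof
    assume bd: "\<forall>k. norm (F (u k)) \<le> B"
    have "inj u"
      by (auto simp: inj_def u_def)
    then have "inj (\<lambda>k. F (u k))"
      using inj_F assms Re_u by (auto simp: inj_def inj_on_def)
    then have "infinite (range (\<lambda>k. F (u k)))"
      by (rule range_inj_infinite)
    moreover have "finite {z \<in> cball 0 B. f z - exp w = 0}"
    proof (rule holomorphic_compact_finite_zeros[where S = UNIV])
      show "\<not> (\<lambda>z. f z - exp w) constant_on UNIV"
        using nonconstant unfolding constant_on_def by (metis diff_add_cancel)
    qed (auto intro!: holomorphic_intros entire)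
    moreover have "range (\<lambda>k. F (u k)) \<subseteq> {z \<in> cball 0 B. f z - exp w = 0}"
      using bd f_F Re_u exp_u assms by auto
    ultimately show False
      by (meson finite_subset)
  qed
  then obtain k where "norm (F (u k)) > B"
    by (auto simp: not_le)
  then show thesis
    using that[OF Re_u exp_u] by blast
qed

lemma vertical_line_attains:
  assumes w: "Re w > ln R" and "norm (F w) \<le> t"
  obtains u where "Re u = Re w" "norm (F u) = t"
proof -
  obtain v where v: "Re v = Re w" "norm (F v) > t"
    using vertical_line_unbounded[OF w] by metis
  have "connected ((\<lambda>u. norm (F u)) ` closed_segment w v)"
  proof (intro connected_continuous_image continuous_on_norm connected_segment)
    have "closed_segment w v \<subseteq> {u. Re u > ln R}"
      using v w by (intro closed_segment_subset convex_halfspace_Re_gt) auto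
    then show "continuous_on (closed_segment w v) F"
      by (rule continuous_on_subset[OF holomorphic_on_imp_continuous_on[OF holo_F]])
  qed
  then have "{norm (F w)..norm (F v)} \<subseteq> (\<lambda>u. norm (F u)) ` closed_segment w v"
    by (rule connected_contains_Icc) auto
  then have "t \<in> (\<lambda>u. norm (F u)) ` closed_segment w v"
    using assms v by auto
  then obtain u where u: "u \<in> closed_segment w v" "norm (F u) = t"
    by auto
  from u(1) obtain a where a: "u = (1 - a) *\<^sub>R w + a *\<^sub>R v"
    by (auto simp: closed_segment_def)
  have "Re u = Re w"
    using v by (simp add: a algebra_simps)
  with u show thesis
    by (intro that)
qed

end

section \<open>Orbits with prescribed moduli\<close>

text \<open>
  If the value \<open>m\<close> were not attained, the part of the closed disc where \<open>z \<in> D\<close> and \<open>|f z| > m\<close>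
  would be open in the disc, and also closed, as \<open>|f| = R < m\<close> on the boundary of \<open>D\<close>.
  As it contains \<open>z0\<close>, it would be the whole connected disc, which contains the point \<open>p\<close> outside \<open>D\<close>.
\<close>
lemma boundary_modulus_attained_in_cball:
  fixes f :: "complex \<Rightarrow> complex"
  assumes "open D" and contf: "continuous_on (closure D) f"
    and fr: "\<And>z. z \<in> frontier D \<Longrightarrow> norm (f z) = R"
    and "m > R" and z0: "z0 \<in> D" "norm z0 \<le> r" "norm (f z0) \<ge> m"
    and p: "p \<notin> D" "norm p \<le> r"
  obtains z where "z \<in> D" "norm z \<le> r" "norm (f z) = m"
proof (rule ccontr)
  note witness = that
  assume neg: "\<not> thesis"
  let ?K = "cball 0 r :: complex set"
  define V where "V = {z \<in> D \<inter> ?K. norm (f z) > m}"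
  have ne: "norm (f z) \<noteq> m" if "z \<in> D" "norm z \<le> r" for z
    using neg witness that by blast
  have contD: "continuous_on D f"
    using contf closure_subset by (rule continuous_on_subset)
  have "open (D \<inter> (\<lambda>z. norm (f z)) -` {m<..})"
    using contD \<open>open D\<close> by (intro continuous_open_preimage continuous_intros) auto
  moreover have "V = ?K \<inter> (D \<inter> (\<lambda>z. norm (f z)) -` {m<..})"
    by (auto simp: V_def)
  ultimately have op: "openin (top_of_set ?K) V"
    by (auto simp: openin_open)
  have "closed (closure D \<inter> (\<lambda>z. norm (f z)) -` {m..})"
    using contf by (intro continuous_closed_preimage continuous_intros) auto
  moreover have "V = ?K \<inter> (closure D \<inter> (\<lambda>z. norm (f z)) -` {m..})"
  proof -
    have "z \<in> D \<and> norm (f z) > m" if "z \<in> ?K" "z \<in> closure D" "norm (f z) \<ge> m" for z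
    proof -
      have "z \<in> D"
        using that fr[of z] \<open>m > R\<close> \<open>open D\<close> by (auto simp: frontier_def interior_open)
      then show ?thesis
        using ne[of z] that by auto
    qed
    then show ?thesis
      using closure_subset[of D] by (auto simp: V_def)
  qed
  ultimately have cl: "closedin (top_of_set ?K) V"
    by (auto simp: closedin_closed)
  have "connected ?K"
    by simp
  then have "V = {} \<or> V = ?K"
    using op cl unfolding connected_clopen by blast
  moreover have "z0 \<in> V"
    using z0 ne[of z0] by (auto simp: V_def)
  moreover have "p \<in> ?K - V"
    using p by (auto simp: V_def)
  ultimately show False
    by blast
qed

text \<open>
  Pulling a point of \<open>E n\<close> back step by step gives an initial point that is right up to time \<open>n\<close>; the
  sets of such points are compact and decrease with \<open>n\<close>.
\<close>
lemma orbit_through_covering_compacts: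
  fixes f :: "'a::heine_borel \<Rightarrow> 'a"
  assumes contf: "continuous_on UNIV f" and comp: "\<And>n. compact (E n)" and ne: "\<And>n. E n \<noteq> {}"
    and cov: "\<And>n. E (Suc n) \<subseteq> f ` E n"
  shows "\<exists>\<zeta>. \<forall>n. (f ^^ n) \<zeta> \<in> E n"
proof -
  have finite_orbit: "\<exists>\<zeta>. \<forall>j\<le>n. (f ^^ j) \<zeta> \<in> E (m + j)" for m n
  proof (induction n arbitrary: m)
    case 0
    then show ?case
      using ne[of m] by auto
  next
    case (Suc n)
    then obtain \<xi> where \<xi>: "\<forall>j\<le>n. (f ^^ j) \<xi> \<in> E (Suc m + j)"
      using Suc.IH[of "Suc m"] by auto
    then have "\<xi> \<in> f ` E m"
      using cov[of m] by force
    then obtain \<zeta> where \<zeta>: "\<zeta> \<in> E m" "f \<zeta> = \<xi>"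
      by auto
    have "(f ^^ j) \<zeta> \<in> E (m + j)" if "j \<le> Suc n" for j
      using that \<zeta> \<xi> by (cases j) (auto simp: funpow_swap1)
    then show ?case
      by blast
  qed
  have "continuous_on UNIV (f ^^ n)" for n
    by (induction n) (auto intro!: continuous_on_compose2[OF contf] simp: id_def o_def)
  then have contn: "isCont (f ^^ n) x" for n x
    by (simp add: continuous_on_eq_continuous_at)
  define K where "K = (\<lambda>n. \<Inter>j\<le>n. (f ^^ j) -` E j)"
  have "\<Inter> (range K) \<noteq> {}"
  proof (rule compact_nest)
    fix n
    have "closed (K n)"
      unfolding K_def using compact_imp_closed[OF comp]
      by (intro closed_INT ballI continuous_closed_vimage) (auto simp: contn)
    moreover have "K n \<subseteq> E 0"
      by (auto simp: K_def)
    ultimately show "compact (K n)"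
      using comp[of 0] by (metis compact_Int_closed inf.absorb_iff2)
    show "K n \<noteq> {}"
      using finite_orbit[of n 0] by (auto simp: K_def)
  next
    show "m \<le> n \<Longrightarrow> K n \<subseteq> K m" for m n
      by (auto simp: K_def)
  qed
  then obtain \<zeta> where "\<And>n. \<zeta> \<in> K n"
    by auto
  then have "(f ^^ n) \<zeta> \<in> E n" for n
    by (auto simp: K_def)
  then show ?thesis
    by blast
qed

text \<open>
  The disc of radius 5 contains the rectangle of half-width \<open>ln 2\<close> and half-height \<open>\<pi>\<close> about its
  centre, and \<open>exp\<close> maps the right half of this rectangle onto the annulus.
\<close>
lemma annulus_subset_exp_cball:
  assumes "\<alpha> > 0" "Re w = ln \<alpha>" "\<alpha> \<le> norm y" "norm y \<le> 2 * \<alpha>"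
  shows "y \<in> exp ` cball w 5"
proof -
  define q where "q = y / exp w"
  have q: "norm q = norm y / \<alpha>"
    using assms by (simp add: q_def norm_divide)
  have q0: "q \<noteq> 0"
    using assms by (auto simp: q_def)
  have "1 \<le> norm q" "norm q \<le> 2"
    unfolding q using assms by (simp_all add: field_simps)
  moreover have "ln (norm q) \<le> norm q - 1"
    using q0 by (intro ln_le_minus_one) simp
  ultimately have "0 \<le> ln (norm q)" "ln (norm q) \<le> 1"
    by auto
  then have "\<bar>Re (Ln q)\<bar> \<le> 1"
    using q0 by simp
  moreover have "\<bar>Im (Ln q)\<bar> \<le> 4"
    using mpi_less_Im_Ln[OF q0] Im_Ln_le_pi[OF q0] pi_less_4 by auto
  ultimately have "norm (Ln q) \<le> 5"
    using cmod_le[of "Ln q"] by simp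
  then have "w + Ln q \<in> cball w 5"
    by (simp add: dist_norm)
  moreover have "exp (w + Ln q) = y"
    using q0 by (simp add: exp_add q_def)
  ultimately show ?thesis
    by (metis imageI)
qed

text \<open>
  A point where half of the supremum is reached is as good as a maximum point for estimates up to a
  constant, and avoids discussing the boundary of \<open>D\<close>.
\<close>
lemma max_modulus_half_attained:
  assumes "connected D" "\<not> bounded D" and contf: "continuous_on UNIV f"
    and nz: "\<And>z. z \<in> D \<Longrightarrow> f z \<noteq> 0" and z1: "z1 \<in> D" "norm z1 \<le> \<rho>"
  obtains z where "z \<in> D" "norm z = \<rho>" "norm (max_modulus_on f D \<rho>) \<le> 2 * norm (f z)"
proof -
  define S where "S = D \<inter> sphere 0 \<rho>"
  obtain z2 where z2: "z2 \<in> D" "norm z2 > \<rho>"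
    using \<open>\<not> bounded D\<close> by (auto simp: bounded_iff not_le)
  have "connected (norm ` D)"
    using \<open>connected D\<close> by (intro connected_continuous_image continuous_intros)
  then have "{norm z1..norm z2} \<subseteq> norm ` D"
    using z1 z2 by (intro connected_contains_Icc) auto
  then have "\<rho> \<in> norm ` D"
    using z1 z2 by auto
  then obtain z3 where z3: "z3 \<in> S"
    by (auto simp: S_def)
  have "bounded ((\<lambda>z. norm (f z)) ` sphere 0 \<rho>)"
    using contf by (intro compact_imp_bounded compact_continuous_image continuous_on_norm)
      (auto intro: continuous_on_subset)
  then have bdd: "bdd_above ((\<lambda>z. norm (f z)) ` S)"
    by (rule bdd_above_mono[OF bounded_imp_bdd_above]) (auto simp: S_def)
  have "0 < norm (f z3)"
    using nz z3 by (auto simp: S_def)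
  also have "\<dots> \<le> (SUP z\<in>S. norm (f z))"
    using bdd z3 by (rule cSUP_upper2) simp
  finally have pos: "0 < (SUP z\<in>S. norm (f z))" .
  then have "(SUP z\<in>S. norm (f z)) / 2 < (SUP z\<in>S. norm (f z))"
    by simp
  then obtain z where "z \<in> S" "(SUP z\<in>S. norm (f z)) / 2 < norm (f z)"
    using less_cSUP_iff[OF _ bdd] z3 by blast
  then show thesis
    using that[of z] pos by (auto simp: S_def max_modulus_on_def)
qed

context log_tract_parametrization
begin

lemma contf: "continuous_on S f"
  using entire by (meson continuous_on_subset holomorphic_on_imp_continuous_on subset_UNIV)

text \<open>
  The core of the construction. By the distortion estimate \<open>exp v\<close> bounds the change of \<open>|F|\<close>, up to
  terms \<open>|p|\<close>, over distances at most \<open>L\<close> in \<open>Re u \<ge> ln \<alpha>' - L\<close>. It is used twice: to find a point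
  with real part \<open>ln \<alpha>'\<close> at which \<open>|F|\<close> is at most \<open>t = exp v (\<alpha> + |p|) + |p|\<close>, and to
  control \<open>|F|\<close> on the disc about the point \<open>w\<close> of the same vertical line at which \<open>|F| = t\<close>. The
  choice of \<open>t\<close> is the one for which the lower bound on the disc is exactly \<open>\<alpha>\<close>.
\<close>
lemma annulus_step:
  assumes "open D" and fr: "\<And>z. z \<in> frontier D \<Longrightarrow> norm (f z) = R"
    and L: "L \<ge> 5" "ln \<alpha>' - L > ln R" and \<alpha>': "\<alpha>' > 0" and p: "norm p \<le> \<alpha>"
    and z0: "z0 \<in> D" "norm z0 = \<alpha>" "\<alpha>' \<le> exp L * norm (f z0)"
    and v: "v = 12 * pi * L / (ln \<alpha>' - L - ln R)"
  obtains w where "Re w = ln \<alpha>'" "\<And>u. u \<in> cball w 5 \<Longrightarrow> Re u > ln R"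
    "\<And>u. u \<in> cball w 5 \<Longrightarrow> \<alpha> \<le> norm (F u)"
    "\<And>u. u \<in> cball w 5 \<Longrightarrow> norm (F u) \<le> exp v * (exp v * (\<alpha> + norm p) + 2 * norm p) + norm p"
proof -
  define s where "s = ln \<alpha>' - L"
  define t where "t = exp v * (\<alpha> + norm p) + norm p"
  have s: "s > ln R"
    using L by (simp add: s_def)
  have "v \<ge> 0"
    using L unfolding v by simp
  have dist: "norm (F u) \<le> exp v * (norm (F w) + norm p) + norm p"
    if "s \<le> Re u" "s \<le> Re w" "norm (u - w) \<le> L" for u w
  proof -
    have "12 * pi * norm (u - w) / (s - ln R) \<le> v"
      unfolding v s_def[symmetric] using s that by (intro divide_right_mono) auto
    then have "exp (12 * pi * norm (u - w) / (s - ln R)) * (norm (F w) + norm p)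
        \<le> exp v * (norm (F w) + norm p)"
      by (intro mult_right_mono) auto
    then show ?thesis
      using distortion[OF s that(1,2)] by linarith
  qed
  have pos: "norm (f z0) > 0"
    using norm_f_gt[OF z0(1)] R_pos by linarith
  have "ln \<alpha>' \<le> ln (exp L * norm (f z0))"
    using z0(3) \<alpha>' pos by (subst ln_le_cancel_iff) auto
  then have lnle: "ln \<alpha>' \<le> L + ln (norm (f z0))"
    using pos by (simp add: ln_mult)
  obtain w1 where w1: "Re w1 = ln \<alpha>'" "norm (F w1) \<le> t"
  proof (cases "norm (f z0) \<le> \<alpha>'")
    case True
    obtain w0 where w0: "z0 = F w0" "Re w0 = ln (norm (f z0))"
      using D_cases[OF z0(1)] by blast
    \<comment> \<open>to the right of \<open>z0\<close> by at most \<open>L\<close> in logarithmic coordinates\<close>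
    define h where "h = ln \<alpha>' - ln (norm (f z0))"
    have h: "0 \<le> h" "h \<le> L"
      using True pos \<alpha>' lnle by (simp_all add: h_def)
    have "norm (F (w0 + of_real h)) \<le> exp v * (norm (F w0) + norm p) + norm p"
      using h lnle w0(2) by (intro dist) (auto simp: s_def)
    then show thesis
      using w0 z0(2) by (intro that[of "w0 + of_real h"]) (simp_all add: h_def t_def)
  next
    case False
    have "ln R < ln \<alpha>'"
      using L by linarith
    then have "R < \<alpha>'"
      using \<alpha>' R_pos by simp
    have "norm z0 \<le> \<alpha>" "\<alpha>' \<le> norm (f z0)"
      using False z0(2) by auto
    then obtain z where z: "z \<in> D" "norm z \<le> \<alpha>" "norm (f z) = \<alpha>'"
      using boundary_modulus_attained_in_cball[OF \<open>open D\<close> contf fr \<open>R < \<alpha>'\<close> z0(1) _ _ p_notin p] by blast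
    obtain w where w: "z = F w" "Re w = ln (norm (f z))"
      using D_cases[OF z(1)] by blast
    have "0 \<le> norm p" "0 \<le> \<alpha> + norm p"
      using z0(2) by auto
    moreover have "\<alpha> + norm p \<le> exp v * (\<alpha> + norm p)"
      using mult_right_mono[of 1 "exp v" "\<alpha> + norm p"] \<open>v \<ge> 0\<close> \<open>0 \<le> \<alpha> + norm p\<close> by simp
    ultimately have "\<alpha> \<le> t"
      unfolding t_def by linarith
    then show thesis
      using w z by (intro that[of w]) auto
  qed
  moreover have "Re w1 > ln R"
    using w1 s L by (simp add: s_def)
  ultimately obtain w where w: "Re w = ln \<alpha>'" "norm (F w) = t"
    using vertical_line_attains by metis
  have near: "norm (u - w) \<le> L" "s \<le> Re u" if "u \<in> cball w 5" for u
  proof -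
    have "norm (u - w) \<le> 5"
      using that by (simp add: dist_norm norm_minus_commute)
    then show "norm (u - w) \<le> L" "s \<le> Re u"
      using L abs_Re_le_cmod[of "u - w"] w(1) by (auto simp: s_def)
  qed
  have sw: "s \<le> Re w"
    using w L by (simp add: s_def)
  show thesis
  proof (rule that[OF w(1)])
    fix u assume u: "u \<in> cball w 5"
    note n = near[OF u]
    show "Re u > ln R"
      using n s by linarith
    have "t \<le> exp v * (norm (F u) + norm p) + norm p"
      using dist[OF sw n(2)] n(1) w(2) by (simp add: norm_minus_commute)
    then show "\<alpha> \<le> norm (F u)"
      by (simp add: t_def)
    show "norm (F u) \<le> exp v * (exp v * (\<alpha> + norm p) + 2 * norm p) + norm p"
      using dist[OF n(2) sw n(1)] unfolding w(2) t_def by (simp add: algebra_simps)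
  qed
qed

text \<open>
  The image under \<open>F\<close> of the disc belonging to \<open>a n\<close> and \<open>a (n + 1)\<close> is mapped by \<open>f\<close> over
  \<open>{a (n + 1) \<le> |z| \<le> 2 a (n + 1)}\<close>, which contains the next image as soon as \<open>\<epsilon> (n + 1) < 1\<close>. The
  lower bound \<open>M\<close> for the starting index \<open>N\<close> is free, so that the first point can be taken outside
  any given disc.
\<close>
lemma slow_escape_in_tract:
  fixes a :: "nat \<Rightarrow> real"
  assumes "open D" and fr: "\<And>z. z \<in> frontier D \<Longrightarrow> norm (f z) = R"
    and a_pos: "\<And>n. a n > 0" and a_top: "filterlim a at_top sequentially" and "C > 0"
    and growth: "\<forall>\<^sub>F n in sequentially. \<exists>z\<in>D. norm z = a n \<and> a (Suc n) \<le> C * norm (f z)"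
  obtains \<epsilon> N \<xi> where "\<epsilon> \<longlonglongrightarrow> 0" "N \<ge> M" "\<And>k. (f ^^ k) \<xi> \<in> D" "\<And>k. a (N + k) \<le> norm ((f ^^ k) \<xi>)"
    "\<And>k. norm ((f ^^ k) \<xi>) \<le> (1 + \<epsilon> (N + k)) * a (N + k)"
proof -
  \<comment> \<open>at least the radius 5 of the discs, and large enough to absorb the constant of the growth condition\<close>
  define L where "L = max 5 (ln C)"
  define v where "v = (\<lambda>n. 12 * pi * L / (ln (a (Suc n)) - L - ln R))"
  \<comment> \<open>chosen so that \<open>(1 + \<epsilon> n) * a n\<close> is the upper bound of \<open>annulus_step\<close> for \<open>\<alpha> = a n\<close>\<close>
  define \<epsilon> where "\<epsilon> = (\<lambda>n. (exp (v n) * (exp (v n) * (a n + norm p) + 2 * norm p) + norm p) / a n - 1)"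
  have ln_top: "filterlim (\<lambda>n. ln (a (Suc n))) at_top sequentially"
    by (intro filterlim_compose[OF ln_at_top] filterlim_compose[OF a_top filterlim_Suc])
  have "filterlim (\<lambda>n. - (L + ln R) + ln (a (Suc n))) at_top sequentially"
    by (intro filterlim_tendsto_add_at_top[OF tendsto_const ln_top])
  then have "v \<longlonglongrightarrow> 0"
    unfolding v_def
    by (intro real_tendsto_divide_at_top[OF tendsto_const]) (simp add: algebra_simps)
  then have ev: "(\<lambda>n. exp (v n)) \<longlonglongrightarrow> exp 0"
    by (intro tendsto_intros)
  have pa: "(\<lambda>n. norm p / a n) \<longlonglongrightarrow> 0"
    by (intro real_tendsto_divide_at_top[OF tendsto_const a_top])
  have "\<epsilon> = (\<lambda>n. exp (v n) * (exp (v n) * (1 + norm p / a n) + 2 * (norm p / a n)) + norm p / a n - 1)"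
    using a_pos by (auto simp: \<epsilon>_def fun_eq_iff field_simps less_imp_neq[symmetric])
  also have "\<dots> \<longlonglongrightarrow> exp 0 * (exp 0 * (1 + 0) + 2 * 0) + 0 - 1"
    by (intro tendsto_intros ev pa)
  finally have eps: "\<epsilon> \<longlonglongrightarrow> 0"
    by simp
  have eps_eq: "(1 + \<epsilon> n) * a n = exp (v n) * (exp (v n) * (a n + norm p) + 2 * norm p) + norm p" for n
    using a_pos[of n] by (simp add: \<epsilon>_def)
  have ln_large: "\<forall>\<^sub>F n in sequentially. ln (a (Suc n)) > L + ln R"
    using ln_top unfolding filterlim_at_top_dense by blast
  have a_large: "\<forall>\<^sub>F n in sequentially. norm p \<le> a n"
    using a_top unfolding filterlim_at_top by blast
  have "\<forall>\<^sub>F n in sequentially. n \<ge> M \<and> ln (a (Suc n)) > L + ln R \<and> norm p \<le> a n \<and> \<epsilon> n < 1 \<and>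
      (\<exists>z\<in>D. norm z = a n \<and> a (Suc n) \<le> C * norm (f z))"
    using order_tendstoD(2)[OF eps, of 1]
    by (intro eventually_conj eventually_ge_at_top ln_large a_large growth) simp
  then obtain N where N: "\<And>n. n \<ge> N \<Longrightarrow> n \<ge> M \<and> ln (a (Suc n)) > L + ln R \<and> norm p \<le> a n \<and> \<epsilon> n < 1 \<and>
      (\<exists>z\<in>D. norm z = a n \<and> a (Suc n) \<le> C * norm (f z))"
    unfolding eventually_sequentially by blast
  have "\<exists>w. Re w = ln (a (Suc (N + k))) \<and> (\<forall>u\<in>cball w 5. Re u > ln R \<and> a (N + k) \<le> norm (F u) \<and>
      norm (F u) \<le> (1 + \<epsilon> (N + k)) * a (N + k))" for k
  proof -
    have Nk: "ln (a (Suc (N + k))) - L > ln R" "norm p \<le> a (N + k)"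
      using N[of "N + k"] by auto
    obtain z where z: "z \<in> D" "norm z = a (N + k)" "a (Suc (N + k)) \<le> C * norm (f z)"
      using N[of "N + k"] by auto
    have "exp (ln C) \<le> exp L"
      by (simp add: L_def)
    then have "C * norm (f z) \<le> exp L * norm (f z)"
      using \<open>C > 0\<close> by (intro mult_right_mono) auto
    then have 1: "a (Suc (N + k)) \<le> exp L * norm (f z)"
      using z(3) by linarith
    have "L \<ge> 5"
      by (simp add: L_def)
    show ?thesis
      unfolding eps_eq
      by (rule annulus_step[OF \<open>open D\<close> fr \<open>L \<ge> 5\<close> Nk(1) a_pos Nk(2) z(1,2) 1 refl]) (auto simp: v_def)
  qed
  then obtain w where w: "\<And>k. Re (w k) = ln (a (Suc (N + k)))"
    and wu: "\<And>k. \<forall>u\<in>cball (w k) 5. Re u > ln R \<and> a (N + k) \<le> norm (F u) \<and>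
      norm (F u) \<le> (1 + \<epsilon> (N + k)) * a (N + k)"
    by metis
  define E where "E = (\<lambda>k. F ` cball (w k) 5)"
  have "\<exists>\<xi>. \<forall>k. (f ^^ k) \<xi> \<in> E k"
  proof (rule orbit_through_covering_compacts[of f E])
    show "continuous_on UNIV f"
      by (rule contf)
    fix k
    have "cball (w k) 5 \<subseteq> {u. Re u > ln R}"
      using wu[of k] by auto
    then show "compact (E k)"
      unfolding E_def
      by (intro compact_continuous_image compact_cball
          continuous_on_subset[OF holomorphic_on_imp_continuous_on[OF holo_F]])
    show "E k \<noteq> {}"
      by (auto simp: E_def)
    show "E (Suc k) \<subseteq> f ` E k"
    proof
      fix y assume "y \<in> E (Suc k)"
      then have y: "a (N + Suc k) \<le> norm y" "norm y \<le> (1 + \<epsilon> (N + Suc k)) * a (N + Suc k)"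
        using wu[of "Suc k"] by (auto simp: E_def)
      have "(1 + \<epsilon> (N + Suc k)) * a (N + Suc k) \<le> 2 * a (N + Suc k)"
        using N[of "N + Suc k"] a_pos[of "N + Suc k"] by (intro mult_right_mono) auto
      with y have "norm y \<le> 2 * a (Suc (N + k))" "a (Suc (N + k)) \<le> norm y"
        by simp_all
      then obtain u where u: "u \<in> cball (w k) 5" "y = exp u"
        using annulus_subset_exp_cball[OF a_pos w] by blast
      then have "f (F u) = y"
        using wu[of k] f_F by auto
      then show "y \<in> f ` E k"
        using u(1) unfolding E_def by blast
    qed
  qed
  then obtain \<xi> where \<xi>: "\<And>k. (f ^^ k) \<xi> \<in> E k"
    by blast
  show thesis
  proof (rule that[OF eps])
    fix k
    obtain u where "u \<in> cball (w k) 5" "(f ^^ k) \<xi> = F u"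
      using \<xi>[of k] by (auto simp: E_def)
    then show "(f ^^ k) \<xi> \<in> D" "a (N + k) \<le> norm ((f ^^ k) \<xi>)"
        "norm ((f ^^ k) \<xi>) \<le> (1 + \<epsilon> (N + k)) * a (N + k)"
      using wu[of k] F_in_D by auto
  qed (use N in blast)
qed

text \<open>
  Only points of modulus greater than \<open>R\<close> have preimages in \<open>D\<close>. Since each fibre in \<open>D\<close> is
  unbounded, the preimages can be chosen with modulus greater than \<open>R\<close> again.
\<close>
lemma backward_orbit_in_tract:
  assumes "\<xi> \<in> D" "norm \<xi> > R"
  shows "\<exists>\<zeta>. (f ^^ n) \<zeta> = \<xi> \<and> (\<forall>j\<le>n. (f ^^ j) \<zeta> \<in> D)"
proof -
  have "\<exists>\<zeta>. (f ^^ n) \<zeta> = \<xi> \<and> (\<forall>j\<le>n. (f ^^ j) \<zeta> \<in> D) \<and> norm \<zeta> > R"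
  proof (induction n)
    case 0
    then show ?case
      using assms by auto
  next
    case (Suc n)
    then obtain \<zeta> where \<zeta>: "(f ^^ n) \<zeta> = \<xi>" "\<forall>j\<le>n. (f ^^ j) \<zeta> \<in> D" "norm \<zeta> > R"
      by blast
    then have "\<zeta> \<noteq> 0"
      using R_pos by auto
    then have "Re (Ln \<zeta>) > ln R"
      using \<zeta>(3) R_pos by simp
    then obtain u where u: "Re u = Re (Ln \<zeta>)" "exp u = exp (Ln \<zeta>)" "norm (F u) > R"
      by (rule vertical_line_unbounded)
    then have f: "f (F u) = \<zeta>" "F u \<in> D"
      using \<open>Re (Ln \<zeta>) > ln R\<close> \<open>\<zeta> \<noteq> 0\<close> by (simp_all add: f_F F_in_D)
    have "(f ^^ j) (F u) \<in> D" if "j \<le> Suc n" for j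
      using that f \<zeta>(2) by (cases j) (auto simp: funpow_swap1)
    moreover have "(f ^^ Suc n) (F u) = \<xi>"
      using f \<zeta>(1) by (simp add: funpow_swap1)
    ultimately show ?case
      using u(3) by blast
  qed
  then show ?thesis
    by blast
qed

text \<open>
  For large \<open>n\<close> one has \<open>|z - p| \<le> 2 |z|\<close> and \<open>ln |f z| - ln R \<ge> ln |f z| / 2\<close> at \<open>z = f^n \<zeta>\<close>, which
  turns the constant \<open>12\<pi>\<close> of the expansion estimate into \<open>48\<pi>\<close>.
\<close>
lemma escaping_in_tract_imp_Julia_set:
  assumes orb: "\<And>n. (f ^^ n) \<zeta> \<in> D" and esc: "filterlim (\<lambda>n. norm ((f ^^ n) \<zeta>)) at_top sequentially"
  shows "\<zeta> \<in> Julia_set f"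
proof (rule expanding_escaping_orbit_in_Julia_set[OF entire esc, where K = "48 * pi"])
  show "deriv f ((f ^^ n) \<zeta>) \<noteq> 0" for n
    by (rule deriv_f_nonzero[OF orb])
  have "filterlim (\<lambda>n. norm ((f ^^ Suc n) \<zeta>)) at_top sequentially"
    by (rule filterlim_compose[OF esc filterlim_Suc])
  from filterlim_compose[OF ln_at_top this]
  have "\<forall>\<^sub>F n in sequentially. ln (norm ((f ^^ Suc n) \<zeta>)) \<ge> 2 * ln R"
    unfolding filterlim_at_top by blast
  moreover have "\<forall>\<^sub>F n in sequentially. norm ((f ^^ n) \<zeta>) \<ge> norm p"
    using esc unfolding filterlim_at_top by blast
  ultimately show "\<forall>\<^sub>F n in sequentially. norm ((f ^^ Suc n) \<zeta>) * ln (norm ((f ^^ Suc n) \<zeta>))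
      \<le> 48 * pi * norm ((f ^^ n) \<zeta>) * norm (deriv f ((f ^^ n) \<zeta>))"
  proof eventually_elim
    case (elim n)
    define z where "z = (f ^^ n) \<zeta>"
    have "norm (f z) * ln (norm (f z)) \<le> 2 * (norm (f z) * (ln (norm (f z)) - ln R))"
      using mult_left_mono[OF elim(1), of "norm (f z)"] by (simp add: z_def algebra_simps)
    also have "\<dots> \<le> 2 * (12 * pi * norm (z - p) * norm (deriv f z))"
      using expansion[OF orb[of n], folded z_def] by linarith
    also have "\<dots> \<le> 2 * (12 * pi * (2 * norm z) * norm (deriv f z))"
      using norm_triangle_ineq4[of z p] elim(2)
      by (intro mult_left_mono mult_right_mono) (auto simp: z_def)
    finally show ?case
      by (simp add: z_def algebra_simps)
  qed
qed simp

end

section \<open>Slow escape in logarithmic tracts\<close>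

theorem theorem1p2:
  fixes f :: "complex \<Rightarrow> complex" and D :: "complex set" and a :: "nat \<Rightarrow> real"
  assumes "transcendental_entire f"
    and "logarithmic_tract f D"
    and "\<And>n. a n > 0"
    and "filterlim a at_top sequentially"
    and "(\<lambda>n. a (Suc n)) \<in> O(\<lambda>n. max_modulus_on f D (a n))"
  shows "\<exists>\<zeta> \<in> Julia_set f \<inter> closure D. \<exists>(N :: nat) (\<epsilon> :: nat \<Rightarrow> real).
           (\<forall>n\<ge>1. (f ^^ n) \<zeta> \<in> closure D) \<and>
           \<epsilon> \<in> o(\<lambda>_. 1) \<and>
           (\<forall>n\<ge>N. 1 \<le> norm ((f ^^ n) \<zeta>) / a n \<and> norm ((f ^^ n) \<zeta>) / a n \<le> 1 + \<epsilon> n)"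
proof -
  from assms(2) obtain R where tract: "direct_tract_with R f D"
    and cov: "covering_space D f {z. norm z > R}" and sc: "simply_connected D"
    unfolding logarithmic_tract_def by blast
  have entire: "f holomorphic_on UNIV" and no_poly: "\<not> (\<exists>q. \<forall>z. f z = poly q z)"
    using assms(1) by (simp_all add: transcendental_entire_def)
  have "open D" "connected D" "\<not> bounded D" "\<not> bounded (- D)" "R > 0"
    and fr: "\<And>z. z \<in> frontier D \<Longrightarrow> norm (f z) = R"
    and gt: "\<And>z. z \<in> D \<Longrightarrow> norm (f z) > R"
    using tract by (auto simp: direct_tract_with_def)
  have "D \<noteq> {}"
    using \<open>\<not> bounded D\<close> by auto
  then obtain z1 where z1: "z1 \<in> D"
    by blast
  obtain F where F: "F holomorphic_on {w. Re w > ln R}" "inj_on F {w. Re w > ln R}"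
    "F ` {w. Re w > ln R} = D" "\<And>w. Re w > ln R \<Longrightarrow> f (F w) = exp w"
    using covering_parametrization_by_exp[OF cov sc \<open>open D\<close> \<open>D \<noteq> {}\<close> _ \<open>R > 0\<close>]
      holomorphic_on_subset[OF entire subset_UNIV] by metis
  obtain p where "p \<notin> D"
    using \<open>\<not> bounded (- D)\<close> by (metis bounded_empty Compl_UNIV_eq UNIV_eq_I)
  have "\<not> f constant_on UNIV"
  proof
    assume "f constant_on UNIV"
    then obtain c where "\<forall>z. f z = poly [:c:] z"
      by (auto simp: constant_on_def)
    with no_poly show False
      by blast
  qed
  interpret log_tract_parametrization f D R F p
    using F \<open>p \<notin> D\<close> \<open>R > 0\<close> entire \<open>\<not> f constant_on UNIV\<close> by unfold_locales auto
  obtain c where "c > 0" and c: "\<forall>\<^sub>F n in sequentially. norm (a (Suc n)) \<le> c * norm (max_modulus_on f D (a n))"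
    using assms(5) by (rule landau_o.bigE)
  have "\<forall>\<^sub>F n in sequentially. norm z1 \<le> a n"
    using assms(4) by (simp add: filterlim_at_top)
  with c have growth: "\<forall>\<^sub>F n in sequentially. \<exists>z\<in>D. norm z = a n \<and> a (Suc n) \<le> 2 * c * norm (f z)"
  proof eventually_elim
    case (elim n)
    have "f z \<noteq> 0" if "z \<in> D" for z
      using gt[OF that] \<open>R > 0\<close> by auto
    then obtain z where z: "z \<in> D" "norm z = a n" "norm (max_modulus_on f D (a n)) \<le> 2 * norm (f z)"
      using max_modulus_half_attained[OF \<open>connected D\<close> \<open>\<not> bounded D\<close> contf _ z1 elim(2)] by metis
    have "a (Suc n) \<le> c * norm (max_modulus_on f D (a n))"
      using elim(1) by simp
    also have "\<dots> \<le> c * (2 * norm (f z))"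
      using z(3) \<open>c > 0\<close> by (intro mult_left_mono) auto
    finally have "a (Suc n) \<le> 2 * c * norm (f z)"
      by simp
    with z show ?case
      by blast
  qed
  have "\<forall>\<^sub>F n in sequentially. a n > R"
    using assms(4) by (simp add: filterlim_at_top_dense)
  then obtain M where M: "\<And>n. n \<ge> M \<Longrightarrow> a n > R"
    unfolding eventually_sequentially by blast
  obtain \<epsilon> N \<xi> where eps: "\<epsilon> \<longlonglongrightarrow> 0" and "N \<ge> M" and \<xi>: "\<And>k. (f ^^ k) \<xi> \<in> D"
    "\<And>k. a (N + k) \<le> norm ((f ^^ k) \<xi>)" "\<And>k. norm ((f ^^ k) \<xi>) \<le> (1 + \<epsilon> (N + k)) * a (N + k)"
    using slow_escape_in_tract[OF \<open>open D\<close> fr assms(3,4) _ growth, of M] \<open>c > 0\<close> by auto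
  have "\<xi> \<in> D" "norm \<xi> > R"
    using \<xi>(1)[of 0] \<xi>(2)[of 0] M[OF \<open>N \<ge> M\<close>] by auto
  then obtain \<zeta> where \<zeta>: "(f ^^ N) \<zeta> = \<xi>" "\<And>j. j \<le> N \<Longrightarrow> (f ^^ j) \<zeta> \<in> D"
    using backward_orbit_in_tract[of \<xi> N] by blast
  have tail: "(f ^^ n) \<zeta> = (f ^^ (n - N)) \<xi>" if "n \<ge> N" for n
    using that \<zeta>(1) funpow_add[of "n - N" N f] by simp
  have orb: "(f ^^ n) \<zeta> \<in> D" for n
    using \<zeta>(2)[of n] tail[of n] \<xi>(1)[of "n - N"] by (cases "n \<le> N") auto
  have lower: "a n \<le> norm ((f ^^ n) \<zeta>)" and upper: "norm ((f ^^ n) \<zeta>) \<le> (1 + \<epsilon> n) * a n" if "n \<ge> N" for n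
    using tail[OF that] \<xi>(2,3)[of "n - N"] that by auto
  have "filterlim (\<lambda>n. norm ((f ^^ n) \<zeta>)) at_top sequentially"
    by (rule filterlim_at_top_mono[OF assms(4) eventually_mono[OF eventually_ge_at_top[of N] lower]])
  then have "\<zeta> \<in> Julia_set f"
    using orb by (intro escaping_in_tract_imp_Julia_set)
  moreover have "(f ^^ n) \<zeta> \<in> closure D" for n
    using orb closure_subset by blast
  moreover from this[of 0] have "\<zeta> \<in> closure D"
    by simp
  moreover have "\<epsilon> \<in> o(\<lambda>_. 1)"
    using eps by (intro smalloI_tendsto) auto
  moreover have "1 \<le> norm ((f ^^ n) \<zeta>) / a n \<and> norm ((f ^^ n) \<zeta>) / a n \<le> 1 + \<epsilon> n" if "n \<ge> N" for n
    using lower[OF that] upper[OF that] assms(3)[of n] by (simp add: pos_le_divide_eq pos_divide_le_eq)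
  ultimately show ?thesis
    by blast
qed

end
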